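(* Let $\Lambda$ and $X$ be finite nonempty sets, let $\partial=\{\partial t : t\in\Lambda\}$ be a neighborhood system in $\Lambda$, and let $P_\Lambda$ be a positive random field on $X^\Lambda$. If $P_\Lambda$ is a Markov random field with respect to $\partial$, then $P_\Lambda$ is Gibbsian with a transition energy field $\mathbf{\Delta}_1=\{\Delta_t^z : t\in\Lambda,\ z\in X^{\Lambda\setminus\{t\}}\}$ satisfying $$\Delta_t^{zy}(x,u)=\Delta_t^{zv}(x,u)\qquad\text{for all } t\in\Lambda,\ x,u\in X^t,\ z\in X^{\partial t},\ y,v\in X^{\Lambda\setminus(\{t\}\cup\partial t)}.\qquad( * )$$ Conversely, if the elements of the transition energy field $\mathbf{\Delta}_1$ of the (Gibbs) random field $P_\Lambda$ satisfy $( * )$, then $P_\Lambda$ is a Markov random field with respect to $\partial$.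
   Context: Each point $t\in\Lambda$ is associated with a copy $X^t$ of $X$. For $V\subseteq\Lambda$, $X^V=\{(x_t)_{t\in V}: x_t\in X^t\}$ is the set of configurations on $V$ (with $X^\emptyset$ consisting of the empty configuration only), and $X^{\{t\}}$ is identified with $X^t$. $z_V$ denotes the restriction of a configuration $z$ to $V$. For disjoint $V,I\subset\Lambda$ and $x\in X^V$, $y\in X^I$, $xy\in X^{V\cup I}$ denotes the concatenation: the configuration equal to $x$ on $V$ and to $y$ on $I$ (the order of writing is irrelevant). A random field $P_\Lambda$ is a probability distribution on $X^\Lambda$; it is positive if $P_\Lambda(x)>0$ for all $x\in X^\Lambda$. For $V\subset\Lambda$, $P_V(x)=\sum_{u\in X^{\Lambda\setminus V}}P_\Lambda(xu)$, $x\in X^V$ (with $P_\emptyset=1$). For $t\in\Lambda$, $I\subseteq\Lambda\setminus\{t\}$ and $z\in X^I$, the conditional distribution on $X^t$ given $z$ is $Q_t^z(x)=P_{\{t\}\cup I}(xz)/P_I(z)$, $x\in X^t$. A neighborhood system in $\Lambda$ is a family $\partial=\{\partial t : t\in\Lambda\}$ of sets $\partial t\subset\Lambda$ such that $t\notin\partial t$, and $s\in\partial t$ if and only if $t\in\partial s$, for all $t,s\in\Lambda$. $P_\Lambda$ is a Markov random field with respect to $\partial$ if $Q_t^z(x)=Q_t^{z_{\partial t}}(x)$ for all $t\in\Lambda$, $z\in X^{\Lambda\setminus\{t\}}$, $x\in X^t$. A (one-point) transition energy field in $\Lambda$ is a family $\mathbf{\Delta}_1=\{\Delta_t^z : t\in\Lambda,\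 z\in X^{\Lambda\setminus\{t\}}\}$ of functions $\Delta_t^z: X^t\times X^t\to\mathbb{R}$ such that: (a) for all $t\in\Lambda$, $z\in X^{\Lambda\setminus\{t\}}$ and $x,u,\alpha\in X^t$: $\Delta_t^z(x,u)=\Delta_t^z(x,\alpha)+\Delta_t^z(\alpha,u)$; (b) for all distinct $t,s\in\Lambda$ and all $x,u\in X^t$, $y,v\in X^s$, $z\in X^{\Lambda\setminus\{t,s\}}$: $\Delta_t^{zy}(x,u)+\Delta_s^{zu}(y,v)=\Delta_s^{zx}(y,v)+\Delta_t^{zv}(x,u)$. $P_\Lambda$ is Gibbsian with transition energy field $\mathbf{\Delta}_1$ (equivalently, $\mathbf{\Delta}_1$ is the transition energy field of $P_\Lambda$) if for all $t\in\Lambda$, $z\in X^{\Lambda\setminus\{t\}}$ and $u\in X^t$, $$Q_t^z(x)=\frac{\exp\{\Delta_t^z(x,u)\}}{\sum_{\alpha\in X^t}\exp\{\Delta_t^z(\alpha,u)\}},\qquad x\in X^t .$$ *)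

theory Defs
  imports "HOL-Probability.Probability"
begin

text \<open>
  Configurations are extensional functions.  Concatenation of configurations on disjoint
  sets \<open>V\<close> and \<open>I\<close> is \<open>merge V I (x, y)\<close>.  Since \<open>X\<^sup>t\<close> is identified with the configurations
  on \<open>{t}\<close>, an element of \<open>X\<^sup>t\<close> is just a value in \<open>X\<close>, and its concatenation with a
  configuration \<open>z\<close> on a set not containing \<open>t\<close> is \<open>z(t := x)\<close>.
\<close>

definition configs :: "'b set \<Rightarrow> 'a set \<Rightarrow> ('a \<Rightarrow> 'b) set" where
  "configs X V = V \<rightarrow>\<^sub>E X"

definition random_field :: "'a set \<Rightarrow> 'b set \<Rightarrow> ('a \<Rightarrow> 'b) pmf \<Rightarrow> bool" where
  "random_field L X P \<longleftrightarrow> set_pmf P \<subseteq> configs X L"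

definition positive_field :: "'a set \<Rightarrow> 'b set \<Rightarrow> ('a \<Rightarrow> 'b) pmf \<Rightarrow> bool" where
  "positive_field L X P \<longleftrightarrow> (\<forall>x\<in>configs X L. pmf P x > 0)"

definition marginal ::
    "'a set \<Rightarrow> 'b set \<Rightarrow> ('a \<Rightarrow> 'b) pmf \<Rightarrow> 'a set \<Rightarrow> ('a \<Rightarrow> 'b) \<Rightarrow> real" where
  "marginal L X P V x = (\<Sum>u\<in>configs X (L - V). pmf P (merge V (L - V) (x, u)))"

text \<open>
  The set \<open>I\<close> on which the conditioning configuration \<open>z\<close> lives is an explicit argument.
\<close>

definition cond_dist ::
    "'a set \<Rightarrow> 'b set \<Rightarrow> ('a \<Rightarrow> 'b) pmf \<Rightarrow> 'a \<Rightarrow> 'a set \<Rightarrow> ('a \<Rightarrow> 'b) \<Rightarrow> 'b \<Rightarrow> real" where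
  "cond_dist L X P t I z x = marginal L X P ({t} \<union> I) (z(t := x)) / marginal L X P I z"

definition neighborhood_system :: "'a set \<Rightarrow> ('a \<Rightarrow> 'a set) \<Rightarrow> bool" where
  "neighborhood_system L N \<longleftrightarrow>
     (\<forall>t\<in>L. N t \<subseteq> L \<and> t \<notin> N t) \<and> (\<forall>t\<in>L. \<forall>s\<in>L. s \<in> N t \<longleftrightarrow> t \<in> N s)"

definition markov_field ::
    "'a set \<Rightarrow> 'b set \<Rightarrow> ('a \<Rightarrow> 'a set) \<Rightarrow> ('a \<Rightarrow> 'b) pmf \<Rightarrow> bool" where
  "markov_field L X N P \<longleftrightarrow>
     (\<forall>t\<in>L. \<forall>z\<in>configs X (L - {t}). \<forall>x\<in>X.
        cond_dist L X P t (L - {t}) z x = cond_dist L X P t (N t) (restrict z (N t)) x)"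

text \<open>
  In a family \<open>D\<close>, the value \<open>D t z x u\<close> is meaningful only for \<open>t \<in> L\<close>, \<open>z\<close> a configuration
  on \<open>L - {t}\<close>, and \<open>x\<close>, \<open>u\<close> in \<open>X\<close>; all other values are irrelevant.
\<close>

definition transition_energy_field ::
    "'a set \<Rightarrow> 'b set \<Rightarrow> ('a \<Rightarrow> ('a \<Rightarrow> 'b) \<Rightarrow> 'b \<Rightarrow> 'b \<Rightarrow> real) \<Rightarrow> bool" where
  "transition_energy_field L X D \<longleftrightarrow>
     (\<forall>t\<in>L. \<forall>z\<in>configs X (L - {t}). \<forall>x\<in>X. \<forall>u\<in>X. \<forall>a\<in>X.
        D t z x u = D t z x a + D t z a u) \<and>
     (\<forall>t\<in>L. \<forall>s\<in>L. t \<noteq> s \<longrightarrow>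
        (\<forall>x\<in>X. \<forall>u\<in>X. \<forall>y\<in>X. \<forall>v\<in>X. \<forall>z\<in>configs X (L - {t, s}).
           D t (z(s := y)) x u + D s (z(t := u)) y v =
           D s (z(t := x)) y v + D t (z(s := v)) x u))"

definition gibbsian ::
    "'a set \<Rightarrow> 'b set \<Rightarrow> ('a \<Rightarrow> ('a \<Rightarrow> 'b) \<Rightarrow> 'b \<Rightarrow> 'b \<Rightarrow> real) \<Rightarrow> ('a \<Rightarrow> 'b) pmf \<Rightarrow> bool" where
  "gibbsian L X D P \<longleftrightarrow>
     transition_energy_field L X D \<and>
     (\<forall>t\<in>L. \<forall>z\<in>configs X (L - {t}). \<forall>u\<in>X. \<forall>x\<in>X.
        cond_dist L X P t (L - {t}) z x = exp (D t z x u) / (\<Sum>a\<in>X. exp (D t z a u)))"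

end

theory Submission
  imports Defs
begin

text \<open>
  The canonical energy field of a positive random field is
  \<open>D t z x u = ln (Q t z x / Q t z u)\<close>, where \<open>Q\<close> is the one-point conditional distribution given
  the whole complement of \<open>t\<close>; conversely every energy field determines \<open>Q\<close>.  So the condition on
  the energies says that \<open>Q t z x\<close> depends on \<open>z\<close> only through its restriction to \<open>N t\<close>.  This is the
  Markov property, because the conditional distribution given the restriction is a weighted average
  of the conditional distributions given the extensions of that restriction.
\<close>

section \<open>Configurations: restriction, update, concatenation\<close>

lemma restrict_in_configs: "z \<in> configs X V \<Longrightarrow> W \<subseteq> V \<Longrightarrow> restrict z W \<in> configs X W"
  by (auto simp: configs_def)

lemma fun_upd_in_configs:
  "z \<in> configs X (V - {t}) \<Longrightarrow> x \<in> X \<Longrightarrow> t \<in> V \<Longrightarrow> z(t := x) \<in> configs X V"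
  by (auto simp: configs_def PiE_iff extensional_def)

lemma merge_in_configs:
  "z \<in> configs X V \<Longrightarrow> y \<in> configs X W \<Longrightarrow> merge V W (z, y) \<in> configs X (V \<union> W)"
  by (auto simp: configs_def PiE_iff extensional_def merge_def)

lemma finite_configs: "finite V \<Longrightarrow> finite X \<Longrightarrow> finite (configs X V)"
  by (simp add: configs_def finite_PiE)

lemma configs_nonempty: "X \<noteq> {} \<Longrightarrow> configs X V \<noteq> {}"
  by (simp add: configs_def PiE_eq_empty_iff)

text \<open>The map \<open>(a, y)\<close> to \<open>y(t := a)\<close> is a bijection from
  \<open>X \<times> configs X V\<close> onto the index set; \<open>t \<notin> V\<close> gives
  injectivity.\<close>

lemma sum_configs_insert:
  fixes f :: "('a \<Rightarrow> 'b) \<Rightarrow> real"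
  assumes "t \<notin> V"
  shows "(\<Sum>u\<in>configs X (insert t V). f u) = (\<Sum>a\<in>X. \<Sum>y\<in>configs X V. f (y(t := a)))"
proof -
  have "configs X (insert t V) = (\<lambda>(a, y). y(t := a)) ` (X \<times> configs X V)"
    by (simp add: configs_def PiE_insert_eq)
  moreover have "inj_on (\<lambda>(a, y). y(t := a)) (X \<times> configs X V)"
    using inj_combinator[OF assms, of "\<lambda>_. X"] by (simp add: configs_def)
  ultimately show ?thesis
    by (simp add: sum.reindex sum.cartesian_product case_prod_unfold)
qed

section \<open>Marginals and one-point conditional distributions\<close>

text \<open>The site \<open>t\<close> belongs to the region summed out. Its value is split off from
  the summed configuration and moved into the fixed one, which leaves the marginal on the larger
  set.\<close>

lemma marginal_split:
  assumes "t \<in> L" "t \<notin> V"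
  shows "marginal L X P V z = (\<Sum>a\<in>X. marginal L X P ({t} \<union> V) (z(t := a)))"
proof -
  let ?R = "L - ({t} \<union> V)"
  have eq: "merge V (L - V) (z, y(t := a)) = merge ({t} \<union> V) ?R (z(t := a), y)" for a y
    using assms by (auto simp: merge_def fun_eq_iff)
  have "L - V = insert t ?R" using assms by auto
  then have "marginal L X P V z =
      (\<Sum>a\<in>X. \<Sum>y\<in>configs X ?R. pmf P (merge V (L - V) (z, y(t := a))))"
    unfolding marginal_def using sum_configs_insert[of t ?R] by simp
  then show ?thesis
    unfolding marginal_def eq .
qed

lemma cond_dist_normalized:
  assumes "t \<in> L" "t \<notin> V"
  shows "cond_dist L X P t V z x =
    marginal L X P ({t} \<union> V) (z(t := x)) / (\<Sum>a\<in>X. marginal L X P ({t} \<union> V) (z(t := a)))"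
  unfolding cond_dist_def marginal_split[OF assms] ..

text \<open>The sum has one term, the empty configuration, and concatenation with it leaves the
  extensional \<open>z\<close> unchanged.\<close>

lemma marginal_whole: "z \<in> configs X L \<Longrightarrow> marginal L X P L z = pmf P z"
  by (auto simp: marginal_def configs_def PiE_iff extensional_def merge_def
      intro!: arg_cong[where f = "pmf P"])

text \<open>Conditioning on everything but \<open>t\<close> leaves nothing to sum out in the
  numerator, so point masses of \<open>P\<close> replace marginals.\<close>

lemma cond_dist_complement:
  assumes "t \<in> L" "z \<in> configs X (L - {t})" "x \<in> X"
  shows "cond_dist L X P t (L - {t}) z x =
    pmf P (z(t := x)) / (\<Sum>a\<in>X. pmf P (z(t := a)))"
proof -
  have eq: "{t} \<union> (L - {t}) = L" using assms by auto
  have "marginal L X P L (z(t := a)) = pmf P (z(t := a))" if "a \<in> X" for a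
    using assms that by (intro marginal_whole fun_upd_in_configs)
  then show ?thesis
    unfolding cond_dist_normalized[OF \<open>t \<in> L\<close>, of "L - {t}", simplified eq, simplified]
    using assms by simp
qed

section \<open>Positive random fields and the Markov property\<close>

context
  fixes L :: "'a set" and X :: "'b set" and P :: "('a \<Rightarrow> 'b) pmf"
  assumes finL: "finite L" and finX: "finite X" and neX: "X \<noteq> {}"
    and pos: "positive_field L X P"
begin

lemma sum_pmf_pos:
  assumes "t \<in> L" "z \<in> configs X (L - {t})"
  shows "(\<Sum>a\<in>X. pmf P (z(t := a))) > 0"
  using assms pos by (intro sum_pos finX neX) (auto simp: positive_field_def fun_upd_in_configs)

lemma cond_dist_pos:
  assumes "t \<in> L" "z \<in> configs X (L - {t})" "x \<in> X"
  shows "cond_dist L X P t (L - {t}) z x > 0"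
  using assms pos sum_pmf_pos
  by (auto simp: cond_dist_complement positive_field_def fun_upd_in_configs)

lemma sum_cond_dist:
  assumes "t \<in> L" "z \<in> configs X (L - {t})"
  shows "(\<Sum>x\<in>X. cond_dist L X P t (L - {t}) z x) = 1"
  using assms sum_pmf_pos[OF assms]
  by (simp add: cond_dist_complement sum_divide_distrib[symmetric] cong: sum.cong)

lemma marginal_pos:
  assumes "V \<subseteq> L" "z \<in> configs X V"
  shows "marginal L X P V z > 0"
  unfolding marginal_def
proof (intro sum_pos finite_configs configs_nonempty finX neX)
  show "finite (L - V)" using finL by simp
  have "V \<union> (L - V) = L" using assms by auto
  then show "pmf P (merge V (L - V) (z, u)) > 0" if "u \<in> configs X (L - V)" for u
    using merge_in_configs[OF assms(2) that] pos by (simp add: positive_field_def)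
qed

text \<open>Given \<open>z\<close>, the conditional distribution averages those given the extensions
  of \<open>z\<close> to \<open>L - {t}\<close>, weighted by their marginals. If all of these have
  the value \<open>q\<close> at \<open>x\<close>, so has the average.\<close>

lemma cond_dist_average:
  assumes t: "t \<in> L" and V: "V \<subseteq> L" "t \<notin> V" and z: "z \<in> configs X V" and x: "x \<in> X"
    and const: "\<And>y. y \<in> configs X (L - ({t} \<union> V)) \<Longrightarrow>
      cond_dist L X P t (L - {t}) (merge V (L - ({t} \<union> V)) (z, y)) x = q"
  shows "cond_dist L X P t V z x = q"
proof -
  let ?R = "L - ({t} \<union> V)"
  let ?w = "\<lambda>y. merge V ?R (z, y)"
  have w: "?w y \<in> configs X (L - {t})" if "y \<in> configs X ?R" for y
  proof -
    have "V \<union> ?R = L - {t}" using t V by auto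
    then show ?thesis using merge_in_configs[OF z that] by simp
  qed
  have m: "marginal L X P ({t} \<union> V) (z(t := a)) = (\<Sum>y\<in>configs X ?R. pmf P ((?w y)(t := a)))" for a
  proof -
    have "merge ({t} \<union> V) ?R (z(t := a), y) = (?w y)(t := a)" for y
      using V by (auto simp: merge_def fun_eq_iff)
    then show ?thesis by (simp add: marginal_def)
  qed
  \<comment> \<open>The hypothesis with denominators cleared, so that it can be summed over the
    exterior configurations \<open>y\<close>.\<close>
  have "pmf P ((?w y)(t := x)) = q * (\<Sum>a\<in>X. pmf P ((?w y)(t := a)))"
    if "y \<in> configs X ?R" for y
    using const[OF that, symmetric] sum_pmf_pos[OF t w[OF that]]
    unfolding cond_dist_complement[OF t w[OF that] x] by simp
  then have "marginal L X P ({t} \<union> V) (z(t := x)) =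
      (\<Sum>y\<in>configs X ?R. q * (\<Sum>a\<in>X. pmf P ((?w y)(t := a))))"
    unfolding m by (intro sum.cong) auto
  also have "\<dots> = q * (\<Sum>a\<in>X. marginal L X P ({t} \<union> V) (z(t := a)))"
    unfolding m sum_distrib_left[symmetric] by (subst sum.swap) (rule refl)
  also have "(\<Sum>a\<in>X. marginal L X P ({t} \<union> V) (z(t := a))) = marginal L X P V z"
    by (rule marginal_split[OF t V(2), symmetric])
  finally have "marginal L X P ({t} \<union> V) (z(t := x)) = q * marginal L X P V z" .
  then show ?thesis
    unfolding cond_dist_def using marginal_pos[OF V(1) z]
    by (metis less_irrefl nonzero_mult_div_cancel_right)
qed

text \<open>Compares only conditional distributions given all of \<open>L - {t}\<close>, the ones
  that energies determine. Forwards, both sides equal the conditional distribution given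
  \<open>z\<close> on \<open>N t\<close>; backwards, \<open>cond_dist_average\<close>
  applies.\<close>

lemma markov_field_iff:
  assumes N: "neighborhood_system L N"
  shows "markov_field L X N P \<longleftrightarrow>
    (\<forall>t\<in>L. \<forall>x\<in>X. \<forall>z\<in>configs X (N t).
      \<forall>y\<in>configs X (L - ({t} \<union> N t)). \<forall>v\<in>configs X (L - ({t} \<union> N t)).
        cond_dist L X P t (L - {t}) (merge (N t) (L - ({t} \<union> N t)) (z, y)) x =
        cond_dist L X P t (L - {t}) (merge (N t) (L - ({t} \<union> N t)) (z, v)) x)"
    (is "_ \<longleftrightarrow> ?local")
proof
  assume markov: "markov_field L X N P"
  show ?local
  proof (intro ballI)
    fix t x z y v
    assume t: "t \<in> L" and x: "x \<in> X" and z: "z \<in> configs X (N t)"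
      and y: "y \<in> configs X (L - ({t} \<union> N t))" and v: "v \<in> configs X (L - ({t} \<union> N t))"
    let ?w = "\<lambda>y. merge (N t) (L - ({t} \<union> N t)) (z, y)"
    have "N t \<union> (L - ({t} \<union> N t)) = L - {t}"
      using N t by (auto simp: neighborhood_system_def)
    then have "?w y \<in> configs X (L - {t})" "?w v \<in> configs X (L - {t})"
      using merge_in_configs[OF z y] merge_in_configs[OF z v] by auto
    moreover have "restrict (?w y) (N t) = restrict (?w v) (N t)"
      by (auto simp: merge_def fun_eq_iff)
    ultimately show "cond_dist L X P t (L - {t}) (?w y) x = cond_dist L X P t (L - {t}) (?w v) x"
      using markov t x by (simp add: markov_field_def)
  qed
next
  assume local: ?local
  show "markov_field L X N P"
    unfolding markov_field_def
  proof (intro ballI)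
    fix t z x
    assume t: "t \<in> L" and z: "z \<in> configs X (L - {t})" and x: "x \<in> X"
    let ?R = "L - ({t} \<union> N t)"
    have Nt: "N t \<subseteq> L" "t \<notin> N t"
      using N t by (auto simp: neighborhood_system_def)
    have zN: "restrict z (N t) \<in> configs X (N t)"
      using z Nt by (intro restrict_in_configs[of _ _ "L - {t}"]) auto
    have zR: "restrict z ?R \<in> configs X ?R"
      using z by (intro restrict_in_configs[of _ _ "L - {t}"]) auto
    have "merge (N t) ?R (restrict z (N t), restrict z ?R) = z"
      using z Nt by (auto simp: merge_def fun_eq_iff configs_def PiE_iff extensional_def)
    \<comment> \<open>Here \<open>q\<close> is the left-hand side: \<open>z\<close> itself is one of
      the extensions of its restriction to \<open>N t\<close>, and locality makes all others agree
      with it.\<close>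
    then show "cond_dist L X P t (L - {t}) z x = cond_dist L X P t (N t) (restrict z (N t)) x"
      using local t x zN zR cond_dist_average[OF t Nt zN x] by metis
  qed
qed

section \<open>The canonical energy field\<close>

lemma gibbsian_canonical:
  "gibbsian L X
    (\<lambda>t z x u. ln (cond_dist L X P t (L - {t}) z x / cond_dist L X P t (L - {t}) z u)) P"
    (is "gibbsian L X ?D P")
proof -
  let ?Q = "\<lambda>t z x. cond_dist L X P t (L - {t}) z x"
  \<comment> \<open>The normalizing sum is the same for \<open>x\<close> and \<open>u\<close> and
    cancels, so the energy is a difference of log-probabilities.\<close>
  have D_pmf: "?D t z x u = ln (pmf P (z(t := x))) - ln (pmf P (z(t := u)))"
    if "t \<in> L" "z \<in> configs X (L - {t})" "x \<in> X" "u \<in> X" for t z x u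
  proof -
    have "pmf P (z(t := x)) > 0" "pmf P (z(t := u)) > 0"
      using that pos by (auto simp: positive_field_def fun_upd_in_configs)
    then show ?thesis
      using that sum_pmf_pos[OF that(1,2)] by (simp add: cond_dist_complement ln_div)
  qed
  have "?D t (z(s := y)) x u + ?D s (z(t := u)) y v = ?D s (z(t := x)) y v + ?D t (z(s := v)) x u"
    if "t \<in> L" "s \<in> L" "t \<noteq> s" "x \<in> X" "u \<in> X" "y \<in> X" "v \<in> X" "z \<in> configs X (L - {t, s})"
    for t s x u y v z
  proof -
    have upd: "z(s := a) \<in> configs X (L - {t})" "z(t := a) \<in> configs X (L - {s})" if "a \<in> X" for a
      using \<open>z \<in> _\<close> \<open>t \<in> L\<close> \<open>s \<in> L\<close> \<open>t \<noteq> s\<close> that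
      by (auto simp: configs_def PiE_iff extensional_def)
    \<comment> \<open>Both sides telescope to the log-probability with \<open>x\<close>,
      \<open>y\<close> at \<open>t\<close>, \<open>s\<close> minus that with \<open>u\<close>,
      \<open>v\<close>; \<open>fun_upd_twist\<close> identifies the two orders of updating.\<close>
    show ?thesis
      using that by (simp add: D_pmf upd fun_upd_twist)
  qed
  moreover have "?D t z x u = ?D t z x a + ?D t z a u"
    if "t \<in> L" "z \<in> configs X (L - {t})" "x \<in> X" "u \<in> X" "a \<in> X" for t z x u a
    using that by (simp add: D_pmf)
  ultimately have "transition_energy_field L X ?D"
    unfolding transition_energy_field_def by blast
  moreover have "?Q t z x = exp (?D t z x u) / (\<Sum>a\<in>X. exp (?D t z a u))"
    if "t \<in> L" "z \<in> configs X (L - {t})" "u \<in> X" "x \<in> X" for t z u x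
  proof -
    have "exp (?D t z a u) = ?Q t z a / ?Q t z u" if "a \<in> X" for a
      using cond_dist_pos \<open>t \<in> L\<close> \<open>z \<in> _\<close> \<open>u \<in> X\<close> that by simp
    \<comment> \<open>Since \<open>?Q t z\<close> sums to 1, the denominator is
      \<open>1 / ?Q t z u\<close>.\<close>
    then show ?thesis
      using that cond_dist_pos[OF that(1-3)] sum_cond_dist[OF that(1,2)]
      by (simp add: sum_divide_distrib[symmetric])
  qed
  ultimately show ?thesis
    unfolding gibbsian_def by blast
qed

end

section \<open>Local conditional distributions and local energies\<close>

theorem theorem6:
  fixes L :: "'a set" and X :: "'b set"
    and N :: "'a \<Rightarrow> 'a set" and P :: "('a \<Rightarrow> 'b) pmf"
  assumes "finite L" and "L \<noteq> {}" and "finite X" and "X \<noteq> {}"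
    and "neighborhood_system L N"
    and "random_field L X P" and "positive_field L X P"
  shows "(markov_field L X N P \<longrightarrow>
           (\<exists>D. gibbsian L X D P \<and>
             (\<forall>t\<in>L. \<forall>x\<in>X. \<forall>u\<in>X. \<forall>z\<in>configs X (N t).
               \<forall>y\<in>configs X (L - ({t} \<union> N t)). \<forall>v\<in>configs X (L - ({t} \<union> N t)).
                 D t (merge (N t) (L - ({t} \<union> N t)) (z, y)) x u =
                 D t (merge (N t) (L - ({t} \<union> N t)) (z, v)) x u))) \<and>
         (\<forall>D. gibbsian L X D P \<longrightarrow>
           (\<forall>t\<in>L. \<forall>x\<in>X. \<forall>u\<in>X. \<forall>z\<in>configs X (N t).
             \<forall>y\<in>configs X (L - ({t} \<union> N t)). \<forall>v\<in>configs X (L - ({t} \<union> N t)).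
               D t (merge (N t) (L - ({t} \<union> N t)) (z, y)) x u =
               D t (merge (N t) (L - ({t} \<union> N t)) (z, v)) x u) \<longrightarrow>
           markov_field L X N P)"
proof (intro conjI impI allI)
  note ctx = \<open>finite L\<close> \<open>finite X\<close> \<open>X \<noteq> {}\<close> \<open>positive_field L X P\<close>
  note markov_iff = markov_field_iff[OF ctx \<open>neighborhood_system L N\<close>]
  {
    assume "markov_field L X N P"
    note local = this[unfolded markov_iff]
    show "\<exists>D. gibbsian L X D P \<and>
             (\<forall>t\<in>L. \<forall>x\<in>X. \<forall>u\<in>X. \<forall>z\<in>configs X (N t).
               \<forall>y\<in>configs X (L - ({t} \<union> N t)). \<forall>v\<in>configs X (L - ({t} \<union> N t)).
                 D t (merge (N t) (L - ({t} \<union> N t)) (z, y)) x u =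
                 D t (merge (N t) (L - ({t} \<union> N t)) (z, v)) x u)"
      \<comment> \<open>The witness is the canonical field: its energies are functions of two
        conditional probabilities, and each is local.\<close>
      by (intro exI conjI ballI, rule gibbsian_canonical[OF ctx])
        (intro arg_cong[where f = ln] arg_cong2[where f = "(/)"]; use local in blast)
  next
    fix D
    assume gibbs: "gibbsian L X D P"
      and D: "\<forall>t\<in>L. \<forall>x\<in>X. \<forall>u\<in>X. \<forall>z\<in>configs X (N t).
             \<forall>y\<in>configs X (L - ({t} \<union> N t)). \<forall>v\<in>configs X (L - ({t} \<union> N t)).
               D t (merge (N t) (L - ({t} \<union> N t)) (z, y)) x u =
               D t (merge (N t) (L - ({t} \<union> N t)) (z, v)) x u"
    show "markov_field L X N P"
      unfolding markov_iff
    proof (intro ballI)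
      fix t x z y v
      assume t: "t \<in> L" and x: "x \<in> X" and z: "z \<in> configs X (N t)"
        and y: "y \<in> configs X (L - ({t} \<union> N t))" and v: "v \<in> configs X (L - ({t} \<union> N t))"
      let ?w = "\<lambda>y. merge (N t) (L - ({t} \<union> N t)) (z, y)"
      have "N t \<union> (L - ({t} \<union> N t)) = L - {t}"
        using \<open>neighborhood_system L N\<close> t by (auto simp: neighborhood_system_def)
      then have w: "?w y \<in> configs X (L - {t})" "?w v \<in> configs X (L - {t})"
        using merge_in_configs[OF z y] merge_in_configs[OF z v] by auto
      \<comment> \<open>The reference value \<open>u\<close> of the Gibbs formula is taken to be
        \<open>x\<close>, which is already known to lie in \<open>X\<close>.\<close>
      have Q: "cond_dist L X P t (L - {t}) w x = exp (D t w x x) / (\<Sum>a\<in>X. exp (D t w a x))"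
        if "w \<in> configs X (L - {t})" for w
        using gibbs t x that by (simp add: gibbsian_def)
      have "D t (?w y) a x = D t (?w v) a x" if "a \<in> X" for a
        using D t x z y v that by blast
      then show "cond_dist L X P t (L - {t}) (?w y) x = cond_dist L X P t (L - {t}) (?w v) x"
        unfolding Q[OF w(1)] Q[OF w(2)] using x by (simp cong: sum.cong)
    qed
  }
qed

end
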